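(* Let $\boldsymbol\omega\in\mathbb{R}^{d^n}$ be a real random matrix product state (rMPS) of order $n$, physical dimension $d$ and bond dimension $\chi$. Then its fourth-moment tensor $\mathcal M=\mathbb{E}[\boldsymbol\omega^{\otimes4}]$ is given, for all multi-indices $\boldsymbol i,\boldsymbol j,\boldsymbol k,\boldsymbol\ell\in\{1,\dots,d\}^n$, by $$\mathcal M(\boldsymbol i,\boldsymbol j,\boldsymbol k,\boldsymbol\ell)=\sum_{\alpha_1,\dots,\alpha_n=1}^{3}\ \prod_{p=1}^{n}\mathcal W_d(i_p,j_p,k_p,\ell_p,\alpha_p)\ \prod_{p=1}^{n-1}\mathbf T(\alpha_p,\alpha_{p+1}),$$ where $$\mathbf T=\begin{bmatrix}1&1/\chi&1/\chi\\1/\chi&1&1/\chi\\1/\chi&1/\chi&1\end{bmatrix}.$$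
   Context: The fourth-moment tensor of $\boldsymbol\omega$ has entries $\mathcal M(\boldsymbol i,\boldsymbol j,\boldsymbol k,\boldsymbol\ell)=\mathbb{E}[\boldsymbol\omega(\boldsymbol i)\boldsymbol\omega(\boldsymbol j)\boldsymbol\omega(\boldsymbol k)\boldsymbol\omega(\boldsymbol\ell)]$. The Wick tensor $\mathcal W_d\in\{0,1\}^{d\times d\times d\times d\times3}$ is defined for $i,j,k,\ell\in\{1,\dots,d\}$ by $\mathcal W_d(i,j,k,\ell,1)=\mathbb 1_{\{i=j\}}\mathbb 1_{\{k=\ell\}}$, $\mathcal W_d(i,j,k,\ell,2)=\mathbb 1_{\{i=k\}}\mathbb 1_{\{j=\ell\}}$, $\mathcal W_d(i,j,k,\ell,3)=\mathbb 1_{\{i=\ell\}}\mathbb 1_{\{j=k\}}$. Let $d,\chi\ge1$ and $n\ge2$ be integers. A real rMPS of order $n$, physical dimension $d$ and bond dimension $\chi$ is the random vector $\boldsymbol\omega\in\mathbb{R}^{d^n}$ with entries indexed by $(i_1,\dots,i_n)\in\{1,\dots,d\}^n$, $$\boldsymbol\omega(i_1,\dots,i_n)=\sum_{\alpha_1,\dots,\alpha_{n-1}=1}^{\chi}G_1(i_1,\alpha_1)\,G_2(\alpha_1,i_2,\alpha_2)\cdots G_{n-1}(\alpha_{n-2},i_{n-1},\alpha_{n-1})\,G_n(\alpha_{n-1},i_n),$$ where $G_1\in\mathbb{R}^{d\times\chi}$, $G_n\in\mathbb{R}^{\chi\times d}$, $G_p\in\mathbb{R}^{\chi\times d\times\chi}$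 for $1<p<n$, and all entries of all cores are independent centered real Gaussians, with variance $1/\chi$ for the entries of $G_p$, $1<p<n$, and variance $1/\sqrt\chi$ for the entries of $G_1$ and $G_n$. *)

theory Defs
  imports "HOL-Probability.Probability"
begin

(* Positions of the entries of all cores: G_1(i,a), G_p(a,i,b) for 1 < p < n, and G_n(a,i).
   A single index type is needed to express joint independence across cores. *)
datatype core_entry =
    First nat nat
  | Mid nat nat nat nat
  | Last nat nat

definition core_entries :: "nat \<Rightarrow> nat \<Rightarrow> nat \<Rightarrow> core_entry set" where
  "core_entries n d chi =
     {First i a | i a. i \<in> {1..d} \<and> a \<in> {1..chi}}
   \<union> {Mid p a i b | p a i b. p \<in> {1<..<n} \<and> a \<in> {1..chi} \<and> i \<in> {1..d} \<and> b \<in> {1..chi}}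
   \<union> {Last a i | a i. a \<in> {1..chi} \<and> i \<in> {1..d}}"

fun core_variance :: "nat \<Rightarrow> core_entry \<Rightarrow> real" where
  "core_variance chi (First i a) = 1 / sqrt (real chi)"
| "core_variance chi (Mid p a i b) = 1 / real chi"
| "core_variance chi (Last a i) = 1 / sqrt (real chi)"

(* The second parameter of normal_density is the standard deviation. *)
definition gaussian_cores ::
    "'a measure \<Rightarrow> nat \<Rightarrow> nat \<Rightarrow> nat \<Rightarrow> (core_entry \<Rightarrow> 'a \<Rightarrow> real) \<Rightarrow> bool" where
  "gaussian_cores M n d chi G \<longleftrightarrow>
     prob_space.indep_vars M (\<lambda>_. borel) G (core_entries n d chi) \<and>
     (\<forall>e \<in> core_entries n d chi.
        distributed M lborel (G e) (normal_density 0 (sqrt (core_variance chi e))))"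

definition multi_indices :: "nat \<Rightarrow> nat \<Rightarrow> (nat \<Rightarrow> nat) set" where
  "multi_indices n d = {1..n} \<rightarrow>\<^sub>E {1..d}"

definition rmps ::
    "nat \<Rightarrow> nat \<Rightarrow> (core_entry \<Rightarrow> 'a \<Rightarrow> real) \<Rightarrow> (nat \<Rightarrow> nat) \<Rightarrow> 'a \<Rightarrow> real" where
  "rmps n chi G i x =
     (\<Sum>\<alpha> \<in> multi_indices (n - 1) chi.
        G (First (i 1) (\<alpha> 1)) x
        * (\<Prod>p \<in> {1<..<n}. G (Mid p (\<alpha> (p - 1)) (i p) (\<alpha> p)) x)
        * G (Last (\<alpha> (n - 1)) (i n)) x)"

definition fourth_moment_tensor ::
    "'a measure \<Rightarrow> ('i \<Rightarrow> 'a \<Rightarrow> real) \<Rightarrow> 'i \<Rightarrow> 'i \<Rightarrow> 'i \<Rightarrow> 'i \<Rightarrow> real" where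
  "fourth_moment_tensor M \<omega> i j k l =
     prob_space.expectation M (\<lambda>x. \<omega> i x * \<omega> j x * \<omega> k x * \<omega> l x)"

(* The dimension d only bounds the range of i, j, k, l and is therefore not an argument;
   the last argument ranges over {1..3}. *)
definition wick_tensor :: "nat \<Rightarrow> nat \<Rightarrow> nat \<Rightarrow> nat \<Rightarrow> nat \<Rightarrow> real" where
  "wick_tensor i j k l a =
     (if a = 1 then of_bool (i = j) * of_bool (k = l)
      else if a = 2 then of_bool (i = k) * of_bool (j = l)
      else if a = 3 then of_bool (i = l) * of_bool (j = k)
      else 0)"

(* The 3 x 3 matrix T, with rows and columns indexed by {1..3}. *)
definition transfer_matrix :: "nat \<Rightarrow> nat \<Rightarrow> nat \<Rightarrow> real" where
  "transfer_matrix chi a b = (if a = b then 1 else 1 / real chi)"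

end

theory Submission
  imports Defs
begin

text \<open>
  Multiplying out \<open>\<omega>(i) \<omega>(j) \<omega>(k) \<omega>(l)\<close> gives a sum over four bond configurations
  \<open>\<alpha>, \<beta>, \<gamma>, \<delta>\<close> of products of core entries. Each position \<open>p\<close> of the chain contributes four
  entries, all of the core \<open>G\<^sub>p\<close>, and entries of different cores are independent, so the
  expectation of a product is the product over \<open>p\<close> of four-point functions
  (\<open>expectation_prod_mset_sum\<close>). By Isserlis' theorem (\<open>isserlis_four\<close>) a four-point function is
  the squared variance of the core times the number of pairings, out of three, that match equal
  entries. Two entries of a core are equal if and only if their physical indices and all their
  bond indices agree, so the indicator of a pairing \<open>a\<close> is a Wick tensor in the physical indices
  times one Wick tensor for each bond adjacent to the core (\<open>expectation_four_core_at\<close>).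

  Choosing one pairing \<open>a p\<close> at each position turns the product of these sums into a sum over
  \<open>a \<in> {1..3}\<^sup>n\<close>. For fixed \<open>a\<close>, bond \<open>q\<close> occurs in exactly two factors: in the one of core \<open>q\<close>,
  with pairing \<open>a q\<close>, and in the one of core \<open>q + 1\<close>, with pairing \<open>a (q + 1)\<close>. The sum over the
  bond configurations therefore splits into one sum over \<open>{1..\<chi>}\<^sup>4\<close> per bond. It counts the
  quadruples compatible with both pairings: there are \<open>\<chi>\<^sup>2\<close> if the pairings are equal, and \<open>\<chi>\<close>
  otherwise, since two distinct pairings together force all four indices to be equal
  (\<open>sum_wick_tensor_mult\<close>).

  The variances are chosen so that the normalisation is local: the squared variance of a core is
  \<open>1/\<chi>\<close> for each bond adjacent to it (\<open>1/\<chi>\<close> at the two ends of the chain, \<open>1/\<chi>\<^sup>2\<close> in the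
  middle). Every bond thus receives \<open>1/\<chi>\<^sup>2\<close> in total, and its sum becomes \<open>T(a q, a (q + 1))\<close>
  (\<open>sum_bond_weights\<close>).
\<close>

section \<open>Mixed moments of independent Gaussians\<close>

locale independent_gaussians = prob_space M
  for M :: "'a measure" +
  fixes X :: "'e \<Rightarrow> 'a \<Rightarrow> real" and v :: "'e \<Rightarrow> real" and I :: "'e set"
  assumes indep: "indep_vars (\<lambda>_. borel) X I"
    and gaussian: "\<And>e. e \<in> I \<Longrightarrow> distributed M lborel (X e) (normal_density 0 (sqrt (v e)))"
    and variance_pos: "\<And>e. e \<in> I \<Longrightarrow> v e > 0"
begin

lemma integrable_power:
  assumes "e \<in> I"
  shows "integrable M (\<lambda>x. X e x ^ m)"
proof -
  have "integrable lborel (\<lambda>y. normal_density 0 (sqrt (v e)) y * y ^ m)"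
    using integrable_normal_moment[of "sqrt (v e)" 0 m] variance_pos[OF assms] by simp
  then show ?thesis
    by (subst (asm) distributed_integrable[OF gaussian[OF assms]]) auto
qed

lemma moment_density:
  assumes "e \<in> I"
  shows "expectation (\<lambda>x. X e x ^ m) = (\<integral>y. normal_density 0 (sqrt (v e)) y * y ^ m \<partial>lborel)"
  by (subst distributed_integral[OF gaussian[OF assms]]) auto

lemma odd_moment:
  assumes "e \<in> I" and "odd m"
  shows "expectation (\<lambda>x. X e x ^ m) = 0"
proof -
  obtain k where "m = 2 * k + 1"
    using \<open>odd m\<close> by (auto elim: oddE)
  then show ?thesis
    unfolding moment_density[OF assms(1)]
    using integral_normal_moment_odd[of "sqrt (v e)" 0 k] variance_pos[OF assms(1)] by simp
qed

lemma second_moment: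
  assumes "e \<in> I"
  shows "expectation (\<lambda>x. X e x ^ 2) = v e"
  using integral_normal_moment_even[of "sqrt (v e)" 0 1] variance_pos[OF assms]
  by (simp add: moment_density[OF assms])

lemma fourth_moment:
  assumes "e \<in> I"
  shows "expectation (\<lambda>x. X e x ^ 4) = 3 * (v e)\<^sup>2"
  using integral_normal_moment_even[of "sqrt (v e)" 0 2] variance_pos[OF assms]
  by (simp add: moment_density[OF assms] fact_numeral power2_eq_square field_simps)

text \<open>
  Multisets keep track of which factors of a monomial coincide: grouping equal factors into
  powers leaves distinct, hence independent, variables.
\<close>
lemma
  assumes "set_mset A \<subseteq> I"
  shows integrable_prod_mset: "integrable M (\<lambda>x. \<Prod>e\<in>#A. X e x)"
    and expectation_prod_mset:
      "expectation (\<lambda>x. \<Prod>e\<in>#A. X e x) = (\<Prod>e\<in>set_mset A. expectation (\<lambda>x. X e x ^ count A e))"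
proof -
  have "indep_vars (\<lambda>_. borel) X (set_mset A)"
    using indep assms by (rule indep_vars_subset)
  then have *: "indep_vars (\<lambda>_. borel) (\<lambda>e x. X e x ^ count A e) (set_mset A)"
    by (rule indep_vars_compose2) auto
  have int: "integrable M (\<lambda>x. X e x ^ count A e)" if "e \<in> set_mset A" for e
    using that assms by (auto intro: integrable_power)
  show "integrable M (\<lambda>x. \<Prod>e\<in>#A. X e x)"
    unfolding image_prod_mset_multiplicity
    by (rule indep_vars_integrable[OF _ * int]) auto
  show "expectation (\<lambda>x. \<Prod>e\<in>#A. X e x) = (\<Prod>e\<in>set_mset A. expectation (\<lambda>x. X e x ^ count A e))"
    unfolding image_prod_mset_multiplicity
    by (rule indep_vars_lebesgue_integral[OF _ * int]) auto
qed

text \<open>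
  In the formula of \<open>expectation_prod_mset\<close>, the multiplicity of an index in \<open>A + B\<close> is its
  multiplicity in the one block that contains it. The factorisation is thus a regrouping of
  moments of single variables.
\<close>
lemma expectation_prod_mset_union:
  assumes "set_mset A \<subseteq> I" "set_mset B \<subseteq> I" "set_mset A \<inter> set_mset B = {}"
  shows "expectation (\<lambda>x. \<Prod>e\<in>#A + B. X e x)
    = expectation (\<lambda>x. \<Prod>e\<in>#A. X e x) * expectation (\<lambda>x. \<Prod>e\<in>#B. X e x)"
proof -
  let ?m = "\<lambda>C e. expectation (\<lambda>x. X e x ^ count C e)"
  have disj: "count B e = 0" if "e \<in># A" for e
    using assms(3) that by (auto simp: disjoint_iff not_in_iff)
  have disj': "count A e = 0" if "e \<in># B" for e
    using assms(3) that by (meson count_eq_zero_iff disjoint_iff)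
  have "expectation (\<lambda>x. \<Prod>e\<in>#A + B. X e x) = prod (?m (A + B)) (set_mset A \<union> set_mset B)"
    using assms by (subst expectation_prod_mset) auto
  also have "\<dots> = prod (?m (A + B)) (set_mset A) * prod (?m (A + B)) (set_mset B)"
    using assms(3) by (intro prod.union_disjoint) auto
  also have "prod (?m (A + B)) (set_mset A) = prod (?m A) (set_mset A)"
    by (intro prod.cong) (simp_all add: disj)
  also have "prod (?m (A + B)) (set_mset B) = prod (?m B) (set_mset B)"
    by (intro prod.cong) (simp_all add: disj')
  finally show ?thesis
    using assms by (simp add: expectation_prod_mset)
qed

lemma expectation_prod_mset_sum:
  assumes "finite P" "\<And>p. p \<in> P \<Longrightarrow> set_mset (B p) \<subseteq> I"
    "\<And>p q. p \<in> P \<Longrightarrow> q \<in> P \<Longrightarrow> p \<noteq> q \<Longrightarrow> set_mset (B p) \<inter> set_mset (B q) = {}"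
  shows "expectation (\<lambda>x. \<Prod>e\<in>#(\<Sum>p\<in>P. B p). X e x) = (\<Prod>p\<in>P. expectation (\<lambda>x. \<Prod>e\<in>#B p. X e x))"
  using assms
proof (induction P rule: finite_induct)
  case empty
  then show ?case by (simp add: prob_space)
next
  case (insert p P)
  have "expectation (\<lambda>x. \<Prod>e\<in>#B p + (\<Sum>p\<in>P. B p). X e x)
     = expectation (\<lambda>x. \<Prod>e\<in>#B p. X e x) * expectation (\<lambda>x. \<Prod>e\<in>#(\<Sum>p\<in>P. B p). X e x)"
  proof (rule expectation_prod_mset_union)
    show "set_mset (B p) \<inter> set_mset (\<Sum>p\<in>P. B p) = {}"
      using insert.prems(2) insert.hyps by (auto simp: set_mset_sum)
  qed (use insert in \<open>auto simp: set_mset_sum\<close>)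
  then show ?case
    using insert by simp
qed

text \<open>
  The case of four factors of Isserlis' theorem (Wick's formula), with the indices allowed to
  coincide. It reduces to a case distinction on which of the four indices are equal: an index of
  odd multiplicity makes both sides vanish, two pairs match exactly one of the three pairings, and
  four equal indices match all three, in accordance with the fourth moment \<open>3 v\<^sup>2\<close>.
\<close>
lemma isserlis_four:
  assumes "{a, b, c, e} \<subseteq> I"
  shows "expectation (\<lambda>x. X a x * X b x * X c x * X e x)
    = v a * v c * of_bool (a = b \<and> c = e) + v a * v b * of_bool (a = c \<and> b = e)
      + v a * v b * of_bool (a = e \<and> b = c)"
proof -
  have "expectation (\<lambda>x. X a x * X b x * X c x * X e x) = expectation (\<lambda>x. \<Prod>e\<in>#{#a, b, c, e#}. X e x)"
    by (simp add: mult.assoc)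
  also have "\<dots> = (\<Prod>u\<in>{a, b, c, e}. expectation (\<lambda>x. X u x ^ count {#a, b, c, e#} u))"
    using assms by (subst expectation_prod_mset) auto
  also have "\<dots> = v a * v c * of_bool (a = b \<and> c = e) + v a * v b * of_bool (a = c \<and> b = e)
      + v a * v b * of_bool (a = e \<and> b = c)"
  proof -
    \<comment> \<open>The simplifier turns small powers into products, so the moments are restated in that form.
      The parity of 3 is settled beforehand, while it is still a numeral.\<close>
    have "odd (3::nat)"
      by simp
    note third_moment = odd_moment[OF _ this]
    have [simp]: "expectation (X u) = 0"
      "expectation (\<lambda>x. X u x * (X u x * X u x)) = 0"
      "expectation (\<lambda>x. X u x * X u x) = v u"
      "expectation (\<lambda>x. X u x * (X u x * (X u x * X u x))) = 3 * (v u * v u)" if "u \<in> I" for u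
      using odd_moment[OF that, of 1] third_moment[OF that] second_moment[OF that] fourth_moment[OF that]
      by (simp_all add: eval_nat_numeral)
    show ?thesis
      using assms
      by (cases "a = b"; cases "a = c"; cases "a = e"; cases "b = c"; cases "b = e"; cases "c = e")
        (auto simp: insert_commute)
  qed
  finally show ?thesis .
qed

end

section \<open>Sums over bond indices\<close>

text \<open>
  A pairing leaves two of the four indices free, whereas two distinct pairings connect all four
  indices and leave only one free.
\<close>
lemma sum_wick_tensor_mult:
  assumes "finite B" "a \<in> {1..3}" "b \<in> {1..3}"
  shows "(\<Sum>s\<in>B. \<Sum>t\<in>B. \<Sum>u\<in>B. \<Sum>w\<in>B. wick_tensor s t u w a * wick_tensor s t u w b)
    = (if a = b then (real (card B))\<^sup>2 else real (card B))"
proof -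
  have "a = 1 \<or> a = 2 \<or> a = 3" "b = 1 \<or> b = 2 \<or> b = 3"
    using assms(2,3) by auto
  \<comment> \<open>The next two rules move indicators outwards, past the sums whose index they do not contain;
    each sum is then left with the indicators that determine its own index.\<close>
  moreover have "(\<Sum>w\<in>B. if P then f w else 0) = (if P then sum f B else 0)" for P and f :: "nat \<Rightarrow> real"
    by simp
  moreover have "(if P then x else 0) * (if Q then y else 0) = (if P then if Q then x * y else 0 else 0)"
    for P Q and x y :: real
    by simp
  ultimately show ?thesis
    using assms(1)
    by (elim disjE)
      (simp_all add: wick_tensor_def of_bool_def power2_eq_square cong: if_cong flip: sum_distrib_left)
qed

text \<open>
  Distributivity, used backwards for each of the four configurations: a summand that is a product
  of local terms allows the index to be summed site by site.
\<close>
lemma sum_PiE_four: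
  fixes F :: "'q \<Rightarrow> 'b \<Rightarrow> 'b \<Rightarrow> 'b \<Rightarrow> 'b \<Rightarrow> 'c::comm_semiring_1"
  assumes "finite A" "finite B"
  shows "(\<Sum>\<alpha>\<in>A \<rightarrow>\<^sub>E B. \<Sum>\<beta>\<in>A \<rightarrow>\<^sub>E B. \<Sum>\<gamma>\<in>A \<rightarrow>\<^sub>E B. \<Sum>\<delta>\<in>A \<rightarrow>\<^sub>E B.
      \<Prod>q\<in>A. F q (\<alpha> q) (\<beta> q) (\<gamma> q) (\<delta> q))
    = (\<Prod>q\<in>A. \<Sum>s\<in>B. \<Sum>t\<in>B. \<Sum>u\<in>B. \<Sum>w\<in>B. F q s t u w)"
  using assms by (simp add: prod_sum_PiE)

lemma sum_product_four:
  fixes f g h k :: "_ \<Rightarrow> _::comm_semiring_0"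
  shows "sum f A * sum g B * sum h C * sum k D
    = (\<Sum>a\<in>A. \<Sum>b\<in>B. \<Sum>c\<in>C. \<Sum>d\<in>D. f a * g b * h c * k d)"
  by (simp flip: sum_distrib_left sum_distrib_right)

lemma image_prod_mset_sum:
  fixes f :: "'e \<Rightarrow> 'b::comm_monoid_mult"
  assumes "finite P"
  shows "(\<Prod>e\<in>#(\<Sum>p\<in>P. B p). f e) = (\<Prod>p\<in>P. \<Prod>e\<in>#B p. f e)"
  using assms by (induction P) auto

section \<open>The cores of a matrix product state\<close>

text \<open>
  The entry that position \<open>p\<close> contributes to the summand \<open>\<alpha>\<close> of \<open>\<omega>(i)\<close>. Treating the end cores on
  the same footing as the middle ones makes each summand a product over \<open>{1..n}\<close>.
\<close>
definition core_at :: "nat \<Rightarrow> (nat \<Rightarrow> nat) \<Rightarrow> (nat \<Rightarrow> nat) \<Rightarrow> nat \<Rightarrow> core_entry" where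
  "core_at n i \<alpha> p =
     (if p = 1 then First (i 1) (\<alpha> 1)
      else if p = n then Last (\<alpha> (n - 1)) (i n)
      else Mid p (\<alpha> (p - 1)) (i p) (\<alpha> p))"

lemma core_at_in_core_entries:
  assumes "n \<ge> 2" "i \<in> multi_indices n d" "\<alpha> \<in> multi_indices (n - 1) chi" "p \<in> {1..n}"
  shows "core_at n i \<alpha> p \<in> core_entries n d chi"
proof -
  have i: "q \<in> {1..n} \<Longrightarrow> i q \<in> {1..d}" for q
    using assms(2) unfolding multi_indices_def by (rule PiE_mem)
  have \<alpha>: "q \<in> {1..n - 1} \<Longrightarrow> \<alpha> q \<in> {1..chi}" for q
    using assms(3) unfolding multi_indices_def by (rule PiE_mem)
  have "p - 1 \<in> {1..n - 1}" if "p \<noteq> 1"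
    using that assms(4) by auto
  then show ?thesis
    using i[of 1] i[of n] i[of p] \<alpha>[of 1] \<alpha>[of "n - 1"] \<alpha>[of "p - 1"] \<alpha>[of p] assms(1,4)
    by (auto simp: core_at_def core_entries_def)
qed

text \<open>
  This makes the blocks of entries at different positions disjoint, hence independent.
\<close>
lemma core_at_eq_imp_same_core:
  assumes "core_at n i \<alpha> p = core_at n j \<beta> q" "n \<ge> 2"
  shows "p = q"
  using assms by (auto simp: core_at_def split: if_splits)

lemma rmps_eq_sum_prod_core_at:
  assumes "n \<ge> 2"
  shows "rmps n chi G i x = (\<Sum>\<alpha>\<in>multi_indices (n - 1) chi. \<Prod>p=1..n. G (core_at n i \<alpha> p) x)"
  unfolding rmps_def
proof (rule sum.cong[OF refl])
  fix \<alpha>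
  have "{1..n} = insert 1 (insert n {1<..<n})"
    using assms by auto
  then have "(\<Prod>p=1..n. G (core_at n i \<alpha> p) x)
      = G (core_at n i \<alpha> 1) x * (G (core_at n i \<alpha> n) x * (\<Prod>p\<in>{1<..<n}. G (core_at n i \<alpha> p) x))"
    using assms by simp
  also have "(\<Prod>p\<in>{1<..<n}. G (core_at n i \<alpha> p) x)
      = (\<Prod>p\<in>{1<..<n}. G (Mid p (\<alpha> (p - 1)) (i p) (\<alpha> p)) x)"
    by (intro prod.cong) (auto simp: core_at_def)
  finally show "G (First (i 1) (\<alpha> 1)) x
        * (\<Prod>p \<in> {1<..<n}. G (Mid p (\<alpha> (p - 1)) (i p) (\<alpha> p)) x)
        * G (Last (\<alpha> (n - 1)) (i n)) x = (\<Prod>p=1..n. G (core_at n i \<alpha> p) x)"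
    using assms by (simp add: core_at_def mult_ac)
qed

text \<open>
  The contribution of bond \<open>q\<close> to one adjacent core with pairing \<open>a\<close>. The factor \<open>1/\<chi>\<close> is the
  share of that bond in the squared variance of the core.
\<close>
definition bond_weight ::
    "nat \<Rightarrow> (nat \<Rightarrow> nat) \<Rightarrow> (nat \<Rightarrow> nat) \<Rightarrow> (nat \<Rightarrow> nat) \<Rightarrow> (nat \<Rightarrow> nat) \<Rightarrow> nat \<Rightarrow> nat \<Rightarrow> real" where
  "bond_weight chi \<alpha> \<beta> \<gamma> \<delta> q a = wick_tensor (\<alpha> q) (\<beta> q) (\<gamma> q) (\<delta> q) a / real chi"

lemma sum_bond_weights:
  assumes "chi \<ge> 1" "\<And>p. p \<in> {1..n} \<Longrightarrow> a p \<in> {1..3}"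
  shows "(\<Sum>\<alpha>\<in>multi_indices (n - 1) chi. \<Sum>\<beta>\<in>multi_indices (n - 1) chi.
      \<Sum>\<gamma>\<in>multi_indices (n - 1) chi. \<Sum>\<delta>\<in>multi_indices (n - 1) chi.
        \<Prod>q=1..n - 1. bond_weight chi \<alpha> \<beta> \<gamma> \<delta> q (a q) * bond_weight chi \<alpha> \<beta> \<gamma> \<delta> q (a (q + 1)))
    = (\<Prod>q=1..n - 1. transfer_matrix chi (a q) (a (q + 1)))"
proof -
  let ?F = "\<lambda>q s t u w. wick_tensor s t u w (a q) * wick_tensor s t u w (a (q + 1)) / (real chi)\<^sup>2"
  have "(\<Prod>q=1..n - 1. \<Sum>s\<in>{1..chi}. \<Sum>t\<in>{1..chi}. \<Sum>u\<in>{1..chi}. \<Sum>w\<in>{1..chi}. ?F q s t u w)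
    = (\<Prod>q=1..n - 1. transfer_matrix chi (a q) (a (q + 1)))"
  proof (rule prod.cong[OF refl])
    fix q assume "q \<in> {1..n - 1}"
    then have "a q \<in> {1..3}" "a (q + 1) \<in> {1..3}"
      using assms(2)[of q] assms(2)[of "q + 1"] by auto
    then show "(\<Sum>s\<in>{1..chi}. \<Sum>t\<in>{1..chi}. \<Sum>u\<in>{1..chi}. \<Sum>w\<in>{1..chi}. ?F q s t u w)
      = transfer_matrix chi (a q) (a (q + 1))"
      using sum_wick_tensor_mult[of "{1..chi}" "a q" "a (q + 1)"] assms(1)
      by (simp add: transfer_matrix_def power2_eq_square flip: sum_divide_distrib)
  qed
  then show ?thesis
    unfolding multi_indices_def bond_weight_def
    by (subst (asm) sum_PiE_four[symmetric]) (simp_all add: power2_eq_square)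
qed

text \<open>
  Regrouping from cores to bonds: the left bond of core \<open>p\<close> is bond \<open>p - 1\<close>, missing for \<open>p = 1\<close>,
  and its right bond is bond \<open>p\<close>, missing for \<open>p = n\<close>.
\<close>
lemma prod_pairings_over_chain:
  fixes b :: "nat \<Rightarrow> nat \<Rightarrow> real"
  shows "(\<Prod>p=1..n. w p * (if p = 1 then 1 else b (p - 1) (a p)) * (if p = n then 1 else b p (a p)))
    = (\<Prod>p=1..n. w p) * (\<Prod>q=1..n - 1. b q (a q) * b q (a (q + 1)))"
proof (cases n)
  case (Suc m)
  have "(\<Prod>p=1..n. if p = 1 then 1 else b (p - 1) (a p)) = (\<Prod>p=Suc 1..n. b (p - 1) (a p))"
    unfolding Suc by (subst prod.atLeast_Suc_atMost) (auto intro!: prod.cong)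
  also have "\<dots> = (\<Prod>q=1..n - 1. b q (a (q + 1)))"
    unfolding Suc by (subst prod.shift_bounds_cl_Suc_ivl) simp
  finally have left: "(\<Prod>p=1..n. if p = 1 then 1 else b (p - 1) (a p)) = (\<Prod>q=1..n - 1. b q (a (q + 1)))" .
  have right: "(\<Prod>p=1..n. if p = n then 1 else b p (a p)) = (\<Prod>q=1..n - 1. b q (a q))"
    unfolding Suc by (auto intro!: prod.cong)
  show ?thesis
    unfolding prod.distrib left right by simp
qed simp

section \<open>The fourth moment\<close>

locale gaussian_mps = prob_space M
  for M :: "'a measure" +
  fixes n d chi :: nat and G :: "core_entry \<Rightarrow> 'a \<Rightarrow> real"
  assumes order: "n \<ge> 2" and bond_dim: "chi \<ge> 1" and cores: "gaussian_cores M n d chi G"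

sublocale gaussian_mps \<subseteq> independent_gaussians M G "core_variance chi" "core_entries n d chi"
proof
  show "core_variance chi e > 0" for e
    using bond_dim by (cases e) auto
qed (use cores in \<open>auto simp: gaussian_cores_def\<close>)

context gaussian_mps
begin

text \<open>
  Isserlis' theorem at one core. Equality of core entries means equality of all their indices,
  so the indicator of a pairing factors into physical and bond indices; the end cores lack one
  bond, which their variance \<open>1/\<surd>\<chi>\<close> accounts for.
\<close>
lemma expectation_four_core_at:
  assumes "i \<in> multi_indices n d" "j \<in> multi_indices n d" "k \<in> multi_indices n d" "l \<in> multi_indices n d"
    and "\<alpha> \<in> multi_indices (n - 1) chi" "\<beta> \<in> multi_indices (n - 1) chi"
      "\<gamma> \<in> multi_indices (n - 1) chi" "\<delta> \<in> multi_indices (n - 1) chi"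
    and "p \<in> {1..n}"
  shows "expectation (\<lambda>x. G (core_at n i \<alpha> p) x * G (core_at n j \<beta> p) x
      * G (core_at n k \<gamma> p) x * G (core_at n l \<delta> p) x)
    = (\<Sum>a\<in>{1..3}. wick_tensor (i p) (j p) (k p) (l p) a
        * (if p = 1 then 1 else bond_weight chi \<alpha> \<beta> \<gamma> \<delta> (p - 1) a)
        * (if p = n then 1 else bond_weight chi \<alpha> \<beta> \<gamma> \<delta> p a))"
proof -
  have sub: "{core_at n i \<alpha> p, core_at n j \<beta> p, core_at n k \<gamma> p, core_at n l \<delta> p} \<subseteq> core_entries n d chi"
    using assms order by (auto intro: core_at_in_core_entries)
  have three: "{1..3::nat} = {1, 2, 3}"
    by auto
  have [simp]: "sqrt (real chi) * sqrt (real chi) = real chi"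
    by simp
  consider "p = 1" | "p = n" "p \<noteq> 1" | "p \<noteq> 1" "p \<noteq> n"
    by blast
  then show ?thesis
    unfolding isserlis_four[OF sub] three
    by cases (use order in \<open>simp_all add: core_at_def wick_tensor_def bond_weight_def of_bool_conj mult_ac\<close>)
qed

text \<open>
  For fixed bond configurations the cores factor, and expanding the product over the cores of the
  sums over three pairings gives a sum over all choices of one pairing per core.
\<close>
lemma
  assumes "i \<in> multi_indices n d" "j \<in> multi_indices n d" "k \<in> multi_indices n d" "l \<in> multi_indices n d"
    and "\<alpha> \<in> multi_indices (n - 1) chi" "\<beta> \<in> multi_indices (n - 1) chi"
      "\<gamma> \<in> multi_indices (n - 1) chi" "\<delta> \<in> multi_indices (n - 1) chi"
  defines "Y \<equiv> \<lambda>p x. G (core_at n i \<alpha> p) x * G (core_at n j \<beta> p) x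
      * G (core_at n k \<gamma> p) x * G (core_at n l \<delta> p) x"
  shows integrable_prod_four_core_at: "integrable M (\<lambda>x. \<Prod>p=1..n. Y p x)"
    and expectation_prod_four_core_at:
      "expectation (\<lambda>x. \<Prod>p=1..n. Y p x) =
        (\<Sum>a\<in>multi_indices n 3. (\<Prod>p=1..n. wick_tensor (i p) (j p) (k p) (l p) (a p))
          * (\<Prod>q=1..n - 1. bond_weight chi \<alpha> \<beta> \<gamma> \<delta> q (a q) * bond_weight chi \<alpha> \<beta> \<gamma> \<delta> q (a (q + 1))))"
proof -
  let ?B = "\<lambda>p. {#core_at n i \<alpha> p, core_at n j \<beta> p, core_at n k \<gamma> p, core_at n l \<delta> p#}"
  have Y: "Y p x = (\<Prod>e\<in>#?B p. G e x)" for p x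
    by (simp add: Y_def mult.assoc)
  have prod_Y: "(\<Prod>p=1..n. Y p x) = (\<Prod>e\<in>#(\<Sum>p=1..n. ?B p). G e x)" for x
    unfolding Y by (rule image_prod_mset_sum[symmetric]) simp
  have sub: "set_mset (?B p) \<subseteq> core_entries n d chi" if "p \<in> {1..n}" for p
    using assms(1-8) that order by (auto intro: core_at_in_core_entries)
  have disj: "set_mset (?B p) \<inter> set_mset (?B q) = {}" if "p \<noteq> q" for p q
    using that order by (auto dest!: core_at_eq_imp_same_core)
  show "integrable M (\<lambda>x. \<Prod>p=1..n. Y p x)"
    unfolding prod_Y using sub by (intro integrable_prod_mset) (fastforce simp: set_mset_sum)
  have "expectation (\<lambda>x. \<Prod>p=1..n. Y p x) = (\<Prod>p=1..n. expectation (Y p))"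
    unfolding prod_Y by (subst expectation_prod_mset_sum) (use sub disj in \<open>simp_all add: Y[abs_def]\<close>)
  also have "\<dots> = (\<Prod>p=1..n. \<Sum>a\<in>{1..3}. wick_tensor (i p) (j p) (k p) (l p) a
        * (if p = 1 then 1 else bond_weight chi \<alpha> \<beta> \<gamma> \<delta> (p - 1) a)
        * (if p = n then 1 else bond_weight chi \<alpha> \<beta> \<gamma> \<delta> p a))"
    unfolding Y_def using expectation_four_core_at[OF assms(1-8)] by (intro prod.cong) auto
  also have "\<dots> = (\<Sum>a\<in>multi_indices n 3. \<Prod>p=1..n. wick_tensor (i p) (j p) (k p) (l p) (a p)
        * (if p = 1 then 1 else bond_weight chi \<alpha> \<beta> \<gamma> \<delta> (p - 1) (a p))
        * (if p = n then 1 else bond_weight chi \<alpha> \<beta> \<gamma> \<delta> p (a p)))"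
    unfolding multi_indices_def by (rule prod_sum_PiE) auto
  finally show "expectation (\<lambda>x. \<Prod>p=1..n. Y p x) =
        (\<Sum>a\<in>multi_indices n 3. (\<Prod>p=1..n. wick_tensor (i p) (j p) (k p) (l p) (a p))
          * (\<Prod>q=1..n - 1. bond_weight chi \<alpha> \<beta> \<gamma> \<delta> q (a q) * bond_weight chi \<alpha> \<beta> \<gamma> \<delta> q (a (q + 1))))"
    unfolding prod_pairings_over_chain[where b = "bond_weight chi \<alpha> \<beta> \<gamma> \<delta>"] .
qed

end

theorem theorem4p3:
  fixes M :: "'a measure"
    and n d chi :: nat
    and G :: "core_entry \<Rightarrow> 'a \<Rightarrow> real"
    and i j k l :: "nat \<Rightarrow> nat"
  assumes "prob_space M"
    and "n \<ge> 2" and "d \<ge> 1" and "chi \<ge> 1"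
    and "gaussian_cores M n d chi G"
    and "i \<in> multi_indices n d" and "j \<in> multi_indices n d"
    and "k \<in> multi_indices n d" and "l \<in> multi_indices n d"
  shows "fourth_moment_tensor M (rmps n chi G) i j k l =
    (\<Sum>\<alpha> \<in> multi_indices n 3.
       (\<Prod>p = 1..n. wick_tensor (i p) (j p) (k p) (l p) (\<alpha> p))
       * (\<Prod>p = 1..n - 1. transfer_matrix chi (\<alpha> p) (\<alpha> (p + 1))))"
proof -
  interpret gaussian_mps M n d chi G
    using assms by (intro gaussian_mps.intro gaussian_mps_axioms.intro)
  let ?S = "multi_indices (n - 1) chi"
  let ?Y = "\<lambda>\<alpha> \<beta> \<gamma> \<delta> p x. G (core_at n i \<alpha> p) x * G (core_at n j \<beta> p) x
      * G (core_at n k \<gamma> p) x * G (core_at n l \<delta> p) x"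
  let ?W = "\<lambda>a. \<Prod>p=1..n. wick_tensor (i p) (j p) (k p) (l p) (a p)"
  let ?V = "\<lambda>a \<alpha> \<beta> \<gamma> \<delta>.
    \<Prod>q=1..n - 1. bond_weight chi \<alpha> \<beta> \<gamma> \<delta> q (a q) * bond_weight chi \<alpha> \<beta> \<gamma> \<delta> q (a (q + 1))"
  have expand: "rmps n chi G i x * rmps n chi G j x * rmps n chi G k x * rmps n chi G l x
      = (\<Sum>\<alpha>\<in>?S. \<Sum>\<beta>\<in>?S. \<Sum>\<gamma>\<in>?S. \<Sum>\<delta>\<in>?S. \<Prod>p=1..n. ?Y \<alpha> \<beta> \<gamma> \<delta> p x)" for x
    unfolding rmps_eq_sum_prod_core_at[OF assms(2)] prod.distrib by (rule sum_product_four)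
  have int: "integrable M (\<lambda>x. \<Prod>p=1..n. ?Y \<alpha> \<beta> \<gamma> \<delta> p x)"
    if "\<alpha> \<in> ?S" "\<beta> \<in> ?S" "\<gamma> \<in> ?S" "\<delta> \<in> ?S" for \<alpha> \<beta> \<gamma> \<delta>
    using assms(6-9) that by (rule integrable_prod_four_core_at)
  have "fourth_moment_tensor M (rmps n chi G) i j k l
      = (\<Sum>\<alpha>\<in>?S. \<Sum>\<beta>\<in>?S. \<Sum>\<gamma>\<in>?S. \<Sum>\<delta>\<in>?S. expectation (\<lambda>x. \<Prod>p=1..n. ?Y \<alpha> \<beta> \<gamma> \<delta> p x))"
    unfolding fourth_moment_tensor_def expand
    by (simp only: Bochner_Integration.integral_sum Bochner_Integration.integrable_sum int cong: sum.cong)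
  also have "\<dots> = (\<Sum>\<alpha>\<in>?S. \<Sum>\<beta>\<in>?S. \<Sum>\<gamma>\<in>?S. \<Sum>\<delta>\<in>?S. \<Sum>a\<in>multi_indices n 3. ?W a * ?V a \<alpha> \<beta> \<gamma> \<delta>)"
    by (intro sum.cong refl expectation_prod_four_core_at assms)
  also have "\<dots> = (\<Sum>a\<in>multi_indices n 3. \<Sum>\<alpha>\<in>?S. \<Sum>\<beta>\<in>?S. \<Sum>\<gamma>\<in>?S. \<Sum>\<delta>\<in>?S. ?W a * ?V a \<alpha> \<beta> \<gamma> \<delta>)"
    by (simp only: sum.swap[of _ ?S "multi_indices n 3"])
  also have "\<dots> = (\<Sum>a\<in>multi_indices n 3. ?W a * (\<Prod>q=1..n - 1. transfer_matrix chi (a q) (a (q + 1))))"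
  proof (rule sum.cong[OF refl])
    fix a assume "a \<in> multi_indices n 3"
    then have "a p \<in> {1..3}" if "p \<in> {1..n}" for p
      using that unfolding multi_indices_def by (rule PiE_mem)
    then show "(\<Sum>\<alpha>\<in>?S. \<Sum>\<beta>\<in>?S. \<Sum>\<gamma>\<in>?S. \<Sum>\<delta>\<in>?S. ?W a * ?V a \<alpha> \<beta> \<gamma> \<delta>)
        = ?W a * (\<Prod>q=1..n - 1. transfer_matrix chi (a q) (a (q + 1)))"
      unfolding sum_distrib_left[symmetric] using sum_bond_weights[OF assms(4)] by presburger
  qed
  finally show ?thesis .
qed

end
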